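(* Let $\phi_\theta:\mathbb{R}\to\mathbb{R}$ be any neural network architecture with parameters $\theta\in\mathbb{R}^N$ (with $(\theta,t)\mapsto\phi_\theta(t)$ measurable). Introduce two additional real parameters $\theta^+,\theta^-\in\mathbb{R}$ and define the new architecture $$\widetilde{\phi}_{\theta^+,\theta^-,\theta}(t)=\begin{cases}\phi_\theta(\theta^+t)&\text{if }t\ge 0,\\ \phi_\theta(\theta^-t)&\text{if }t<0.\end{cases}$$ Let $p(\theta^+,\theta)\ge0$ be any measurable function of $N+1$ real variables such that $$\widetilde{P}(\theta^+,\theta^-,\theta)=p(\theta^+,\theta)\,p(-\theta^-,\theta)$$ is a probability density on $\mathbb{R}^{N+2}$. Then the neural network $(\widetilde\phi,\widetilde P)$ is reflection positive: for every $n\ge 1$, all $t_1,\dots,t_n>0$ and every bounded measurable $F:\mathbb{R}^n\to\mathbb{C}$, $$\int d\theta\,d\theta^+\,d\theta^-\;\widetilde P(\theta^+,\theta^-,\theta)\;F\big(\widetilde\phi(t_1),\dots,\widetilde\phi(t_n)\big)\,\Big(F\big(\widetilde\phi(-t_1),\dots,\widetilde\phi(-t_n)\big)\Big)^{*}\ \ge\ 0,$$ where $\widetilde\phi=\widetilde\phi_{\theta^+,\theta^-,\theta}$.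
   Context: A neural network is a parameterized family of functions $\mathbb{R}\to\mathbb{R}$ (the architecture) together with a joint probability density on the parameters. $^*$ denotes complex conjugation. The inequality "$\geq0$" means that the (a priori complex) quantity is real and non-negative. *)

theory Defs
  imports "HOL-Probability.Probability"
begin

text \<open>
  Lebesgue (Borel) measure on the space of real vectors of length \<open>n\<close>, where \<open>n\<close> is a natural number
  that may be quantified over (and may be \<open>0\<close>).  A vector is a function on \<open>{..<n}\<close>, extended by
  \<^const>\<open>undefined\<close> outside; components are numbered from \<open>0\<close>.
\<close>
abbreviation lborel_vec :: "nat \<Rightarrow> (nat \<Rightarrow> real) measure"
  where "lborel_vec n \<equiv> Pi\<^sub>M {..<n} (\<lambda>_. lborel)"

definition prob_density :: "'p measure \<Rightarrow> ('p \<Rightarrow> real) \<Rightarrow> bool"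
  where "prob_density M P \<longleftrightarrow>
    P \<in> borel_measurable M \<and> (\<forall>w\<in>space M. 0 \<le> P w) \<and> (\<integral>\<^sup>+w. ennreal (P w) \<partial>M) = 1"

text \<open>
  A neural network is given by Lebesgue measure \<open>M\<close> on its parameter space, its architecture
  \<open>\<phi>\<close> and the density \<open>P\<close> of its parameters with respect to \<open>M\<close>.  Integrability is
  required explicitly because the Bochner integral of a non-integrable function is \<open>0\<close> by convention.
\<close>
definition reflection_positive ::
  "'p measure \<Rightarrow> ('p \<Rightarrow> real \<Rightarrow> real) \<Rightarrow> ('p \<Rightarrow> real) \<Rightarrow> bool"
  where "reflection_positive M \<phi> P \<longleftrightarrow>
    (\<forall>n\<ge>1. \<forall>t :: nat \<Rightarrow> real. \<forall>F :: (nat \<Rightarrow> real) \<Rightarrow> complex.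
       (\<forall>i<n. 0 < t i) \<longrightarrow>
       F \<in> borel_measurable (lborel_vec n) \<longrightarrow>
       bounded (F ` space (lborel_vec n)) \<longrightarrow>
       (let integrand = (\<lambda>w. complex_of_real (P w)
              * F (\<lambda>i\<in>{..<n}. \<phi> w (t i))
              * cnj (F (\<lambda>i\<in>{..<n}. \<phi> w (- t i))))
        in integrable M integrand \<and> (\<integral>w. integrand w \<partial>M) \<in> \<real>\<^sub>\<ge>\<^sub>0))"

text \<open>Extended parameters are triples \<open>(\<theta>\<^sup>+, \<theta>\<^sup>-, \<theta>)\<close>.\<close>
definition split_arch ::
  "('a \<Rightarrow> real \<Rightarrow> real) \<Rightarrow> real \<times> real \<times> 'a \<Rightarrow> real \<Rightarrow> real"
  where "split_arch \<phi> = (\<lambda>(a, b, \<theta>) t. if t \<ge> 0 then \<phi> \<theta> (a * t) else \<phi> \<theta> (b * t))"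

definition split_density ::
  "(real \<Rightarrow> 'a \<Rightarrow> real) \<Rightarrow> real \<times> real \<times> 'a \<Rightarrow> real"
  where "split_density p = (\<lambda>(a, b, \<theta>). p a \<theta> * p (- b) \<theta>)"

end

theory Submission
  imports Defs
begin

text \<open>
  At a reflected point the architecture evaluates to \<open>\<phi> \<theta> (\<theta>\<^sup>- * - t) = \<phi> \<theta> (- \<theta>\<^sup>- * t)\<close>, so the integrand
  is \<open>K \<theta>\<^sup>+ \<theta> * cnj (K (- \<theta>\<^sup>-) \<theta>)\<close> with \<open>K a \<theta> = p a \<theta> * F (\<phi> \<theta> (a * t\<^sub>1), \<dots>)\<close>.  Integrating first over
  \<open>\<theta>\<^sup>+\<close> and \<open>\<theta>\<^sup>-\<close> gives the squared modulus of \<open>\<integral>a. K a \<theta>\<close> for each \<open>\<theta>\<close>.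
\<close>

lemma integral_mult_cnj_reflection_eq:
  fixes K :: "real \<Rightarrow> 'a \<Rightarrow> complex"
  assumes "sigma_finite_measure M"
    and int: "integrable (lborel \<Otimes>\<^sub>M lborel \<Otimes>\<^sub>M M) (\<lambda>(a, b, \<theta>). K a \<theta> * cnj (K (- b) \<theta>))"
  shows "(\<integral>(a, b, \<theta>). K a \<theta> * cnj (K (- b) \<theta>) \<partial>(lborel \<Otimes>\<^sub>M lborel \<Otimes>\<^sub>M M))
    = complex_of_real (\<integral>\<theta>. (cmod (\<integral>a. K a \<theta> \<partial>lborel))\<^sup>2 \<partial>M)"
proof -
  interpret M: sigma_finite_measure M by fact
  interpret bM: pair_sigma_finite "lborel :: real measure" M ..
  interpret abM: pair_sigma_finite "lborel :: real measure" "lborel \<Otimes>\<^sub>M M"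
    by (intro pair_sigma_finite.intro lborel.sigma_finite_measure_axioms sigma_finite_pair_measure
        M.sigma_finite_measure_axioms)
  define f where "f = (\<lambda>a (b, \<theta>). K a \<theta> * cnj (K (- b) \<theta>))"
  define g where "g = (\<lambda>b \<theta>. \<integral>a. K a \<theta> * cnj (K (- b) \<theta>) \<partial>lborel)"
  have f: "integrable (lborel \<Otimes>\<^sub>M lborel \<Otimes>\<^sub>M M) (case_prod f)"
    using int by (simp add: f_def case_prod_beta')
  have g: "(\<lambda>y. \<integral>a. f a y \<partial>lborel) = case_prod g"
    by (simp add: f_def g_def fun_eq_iff)
  \<comment> \<open>The factor \<open>\<integral>a. K a \<theta>\<close> comes out of the integral
    over \<open>b\<close>, and \<open>b \<mapsto> - b\<close> turns the rest into its conjugate.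
    This holds for every \<open>\<theta>\<close>, not just almost every one: if \<open>K\<close> is
    not integrable in its first argument, both sides take the default value 0.\<close>
  have inner: "(\<integral>b. g b \<theta> \<partial>lborel) = complex_of_real ((cmod (\<integral>a. K a \<theta> \<partial>lborel))\<^sup>2)" for \<theta>
  proof -
    have "(\<integral>b. K (- b) \<theta> \<partial>lborel) = (\<integral>a. K a \<theta> \<partial>lborel)"
      using lborel_integral_real_affine[of "-1" "\<lambda>a. K a \<theta>" 0] by simp
    then show ?thesis
      by (simp add: g_def complex_norm_square del: of_real_power)
  qed
  have "(\<integral>(a, b, \<theta>). K a \<theta> * cnj (K (- b) \<theta>) \<partial>(lborel \<Otimes>\<^sub>M lborel \<Otimes>\<^sub>M M))
      = (\<integral>z. case_prod f z \<partial>(lborel \<Otimes>\<^sub>M lborel \<Otimes>\<^sub>M M))"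
    by (simp add: f_def case_prod_beta')
  also have "\<dots> = (\<integral>y. case_prod g y \<partial>(lborel \<Otimes>\<^sub>M M))"
    using abM.integral_snd[OF f] by (simp add: g)
  \<comment> \<open>Second use of Fubini; the integrability of \<open>g\<close> is inherited from
    the first one.\<close>
  also have "\<dots> = (\<integral>\<theta>. (\<integral>b. g b \<theta> \<partial>lborel) \<partial>M)"
    using bM.integral_snd[of g] abM.integrable_snd[OF f] by (simp add: g)
  finally show ?thesis
    by (simp only: inner integral_complex_of_real)
qed

text \<open>Boundedness of \<open>F\<close> makes a multiple of the density a majorant, so Fubini
  applies and the squared modulus decides the sign. Sigma-finiteness is the only structure of the
  parameter space that enters.\<close>

lemma reflection_positive_split:
  fixes \<phi> :: "'a \<Rightarrow> real \<Rightarrow> real" and p :: "real \<Rightarrow> 'a \<Rightarrow> real"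
  assumes M: "sigma_finite_measure M"
    and \<phi>: "(\<lambda>(\<theta>, t). \<phi> \<theta> t) \<in> borel_measurable (M \<Otimes>\<^sub>M lborel)"
    and p: "(\<lambda>(a, \<theta>). p a \<theta>) \<in> borel_measurable (lborel \<Otimes>\<^sub>M M)"
    and P: "prob_density (lborel \<Otimes>\<^sub>M lborel \<Otimes>\<^sub>M M) (split_density p)"
  shows "reflection_positive (lborel \<Otimes>\<^sub>M lborel \<Otimes>\<^sub>M M) (split_arch \<phi>) (split_density p)"
  unfolding reflection_positive_def Let_def
proof (intro allI impI)
  fix n :: nat and t :: "nat \<Rightarrow> real" and F :: "(nat \<Rightarrow> real) \<Rightarrow> complex"
  assume t: "\<forall>i<n. 0 < t i"
    and F [measurable]: "F \<in> borel_measurable (lborel_vec n)"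
    and bdd: "bounded (F ` space (lborel_vec n))"
  define L where "L = (lborel \<Otimes>\<^sub>M lborel \<Otimes>\<^sub>M M :: (real \<times> real \<times> 'a) measure)"
  define X where "X = (\<lambda>a \<theta>. \<lambda>i\<in>{..<n}. \<phi> \<theta> (a * t i))"
  define K where "K = (\<lambda>a \<theta>. complex_of_real (p a \<theta>) * F (X a \<theta>))"
  define I where "I = (\<lambda>w. complex_of_real (split_density p w)
      * F (\<lambda>i\<in>{..<n}. split_arch \<phi> w (t i)) * cnj (F (\<lambda>i\<in>{..<n}. split_arch \<phi> w (- t i))))"
  have arch: "(\<lambda>i\<in>{..<n}. split_arch \<phi> (a, b, \<theta>) (t i)) = X a \<theta>"
    "(\<lambda>i\<in>{..<n}. split_arch \<phi> (a, b, \<theta>) (- t i)) = X (- b) \<theta>" for a b \<theta>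
    using t by (auto simp: X_def split_arch_def fun_eq_iff restrict_def less_le_not_le)
  \<comment> \<open>Since \<open>p\<close> is real, \<open>p (- b) \<theta>\<close> can be moved
    under the conjugation.\<close>
  have I_eq: "I = (\<lambda>(a, b, \<theta>). K a \<theta> * cnj (K (- b) \<theta>))"
    by (auto simp: I_def K_def arch split_density_def fun_eq_iff)
  have \<phi>_scaled: "(\<lambda>(a, \<theta>). \<phi> \<theta> (a * s)) \<in> borel_measurable (lborel \<Otimes>\<^sub>M M)" for s
    using measurable_compose[OF _ \<phi>, of "\<lambda>(a, \<theta>). (\<theta>, a * s)" "lborel \<Otimes>\<^sub>M M"]
    by (simp add: case_prod_beta')
  have X: "(\<lambda>(a, \<theta>). X a \<theta>) \<in> lborel \<Otimes>\<^sub>M M \<rightarrow>\<^sub>M lborel_vec n"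
    unfolding X_def case_prod_beta'
    by (rule measurable_restrict) (use \<phi>_scaled in \<open>simp add: case_prod_beta'\<close>)
  have K: "(\<lambda>(a, \<theta>). K a \<theta>) \<in> borel_measurable (lborel \<Otimes>\<^sub>M M)"
    using measurable_compose[OF X F] p by (simp add: K_def case_prod_beta')
  \<comment> \<open>Both factors are \<open>K\<close> composed with a measurable map,
    \<open>(a, b, \<theta>) \<mapsto> (a, \<theta>)\<close> or
    \<open>(a, b, \<theta>) \<mapsto> (- b, \<theta>)\<close>.\<close>
  have I_meas: "I \<in> borel_measurable L"
    using measurable_compose[OF _ K, of "\<lambda>(a, b, \<theta>). (a, \<theta>)" L]
      measurable_compose[OF _ K, of "\<lambda>(a, b, \<theta>). (- b, \<theta>)" L]
      borel_measurable_continuous_onI[OF continuous_on_cnj[OF continuous_on_id]]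
    by (simp add: I_eq L_def case_prod_beta' measurable_compose[where g = cnj])
  have P_meas: "split_density p \<in> borel_measurable L"
    and P_nonneg: "\<And>w. w \<in> space L \<Longrightarrow> 0 \<le> split_density p w"
    and P_int: "(\<integral>\<^sup>+w. ennreal (split_density p w) \<partial>L) = 1"
    using P by (auto simp: prob_density_def L_def)
  have P_integrable: "integrable L (split_density p)"
    by (rule integrableI_nonneg) (use P_meas P_nonneg P_int in auto)
  obtain B where B: "\<And>x. x \<in> space (lborel_vec n) \<Longrightarrow> cmod (F x) \<le> B"
    using bdd by (auto simp: bounded_iff)
  have I_le: "cmod (I w) \<le> norm (B * B * split_density p w)" if "w \<in> space L" for w
  proof -
    have "cmod (F (\<lambda>i\<in>{..<n}. split_arch \<phi> w (s i))) \<le> B" for s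
      by (rule B) (auto simp: space_PiM)
    then have "cmod (F (\<lambda>i\<in>{..<n}. split_arch \<phi> w (t i)))
        * cmod (F (\<lambda>i\<in>{..<n}. split_arch \<phi> w (- t i))) \<le> B * B"
      \<comment> \<open>Monotonicity of the product needs \<open>0 \<le> B\<close>, which follows
        because \<open>B\<close> bounds a norm.\<close>
      by (intro mult_mono) (auto intro: order_trans[OF norm_ge_zero])
    from mult_left_mono[OF this P_nonneg[OF that]] show ?thesis
      using P_nonneg[OF that] by (simp add: I_def norm_mult abs_mult ac_simps)
  qed
  have I_integrable: "integrable L I"
    by (rule Bochner_Integration.integrable_bound[OF integrable_mult_right[OF P_integrable, of "B * B"] I_meas])
      (use I_le in auto)
  \<comment> \<open>By the previous lemma the value is the real integral of a square, hence real and
    non-negative.\<close>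
  moreover have "(\<integral>w. I w \<partial>L) \<in> \<real>\<^sub>\<ge>\<^sub>0"
    using integral_mult_cnj_reflection_eq[OF M, of K] I_integrable by (simp add: I_eq L_def)
  ultimately show "integrable (lborel \<Otimes>\<^sub>M lborel \<Otimes>\<^sub>M M) (\<lambda>w. complex_of_real (split_density p w)
      * F (\<lambda>i\<in>{..<n}. split_arch \<phi> w (t i)) * cnj (F (\<lambda>i\<in>{..<n}. split_arch \<phi> w (- t i))))
    \<and> (\<integral>w. complex_of_real (split_density p w) * F (\<lambda>i\<in>{..<n}. split_arch \<phi> w (t i))
      * cnj (F (\<lambda>i\<in>{..<n}. split_arch \<phi> w (- t i))) \<partial>(lborel \<Otimes>\<^sub>M lborel \<Otimes>\<^sub>M M)) \<in> \<real>\<^sub>\<ge>\<^sub>0"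
    by (simp add: I_def L_def)
qed

theorem mainTheorem3:
  fixes N :: nat
    and \<phi> :: "(nat \<Rightarrow> real) \<Rightarrow> real \<Rightarrow> real"
    and p :: "real \<Rightarrow> (nat \<Rightarrow> real) \<Rightarrow> real"
  assumes "(\<lambda>(\<theta>, t). \<phi> \<theta> t) \<in> borel_measurable (lborel_vec N \<Otimes>\<^sub>M lborel)"
    and "(\<lambda>(a, \<theta>). p a \<theta>) \<in> borel_measurable (lborel \<Otimes>\<^sub>M lborel_vec N)"
    and "\<forall>a. \<forall>\<theta>\<in>space (lborel_vec N). 0 \<le> p a \<theta>"
    and "prob_density (lborel \<Otimes>\<^sub>M lborel \<Otimes>\<^sub>M lborel_vec N) (split_density p)"
  shows "reflection_positive (lborel \<Otimes>\<^sub>M lborel \<Otimes>\<^sub>M lborel_vec N) (split_arch \<phi>) (split_density p)"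
proof -
  \<comment> \<open>A finite product of sigma-finite measures is sigma-finite; this includes
    \<open>N = 0\<close>, where the product is a one-point space.\<close>
  interpret finite_product_sigma_finite "\<lambda>_::nat. lborel :: real measure" "{..<N}"
    by standard simp
  have "sigma_finite_measure (lborel_vec N)" ..
  then show ?thesis
    using assms(1,2,4) by (rule reflection_positive_split)
qed

end
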